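(* For every positive odd integer $q$, $n(\mathbb{Z}_q)=q+1$.
   Context: $\mathbb{Z}_q$ denotes the cyclic group of order $q$. A complete digraph is a digraph having both arcs $(x,y)$ and $(y,x)$ for any two distinct vertices $x,y$ (exactly one arc for each ordered pair of distinct vertices, and no loops). For a group $\Gamma$, a $\Gamma$-labelling of a digraph $D$ is a map from the set $A(D)$ of arcs of $D$ to $\Gamma$. A directed cycle has pairwise distinct vertices and length at least $2$ (directed cycles of length $2$ are allowed). A balanced cycle is a directed cycle for which the cumulative product (sum, in additive notation) of its arc-labels, taken in order along the cycle, equals the identity of $\Gamma$; this does not depend on the starting vertex. For a finite group $\Gamma$, $n(\Gamma)$ denotes the smallest positive integer $n$ such that every $\Gamma$-labelled complete digraph on $n$ vertices contains a balanced cycle. *)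

theory Defs
  imports "HOL-Algebra.Elementary_Groups" "Graph_Theory.Kuratowski"
begin

definition labelling :: "('g, 'm) monoid_scheme \<Rightarrow> ('v, 'e) pre_digraph \<Rightarrow> ('e \<Rightarrow> 'g) \<Rightarrow> bool" where
  "labelling \<Gamma> D lab \<longleftrightarrow> lab ` arcs D \<subseteq> carrier \<Gamma>"

text \<open>The product of the labels along a walk, in the order of the walk.\<close>
definition walk_label :: "('g, 'm) monoid_scheme \<Rightarrow> ('e \<Rightarrow> 'g) \<Rightarrow> 'e awalk \<Rightarrow> 'g" where
  "walk_label \<Gamma> lab p = foldr (\<lambda>e x. lab e \<otimes>\<^bsub>\<Gamma>\<^esub> x) p \<one>\<^bsub>\<Gamma>\<^esub>"

text \<open>
  The library predicate \<^const>\<open>pre_digraph.cycle\<close> describes nonempty closed directed walks, given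
  as lists of arcs, without repeated vertices. It admits cycles of length 2, and in a loopfree
  digraph such as a complete one every cycle has length at least 2
  (see \<open>loopfree_digraph.cycle_digraph_conv\<close>).
\<close>
definition balanced_cycle ::
  "('g, 'm) monoid_scheme \<Rightarrow> ('v, 'e) pre_digraph \<Rightarrow> ('e \<Rightarrow> 'g) \<Rightarrow> 'e awalk \<Rightarrow> bool" where
  "balanced_cycle \<Gamma> D lab p \<longleftrightarrow> pre_digraph.cycle D p \<and> walk_label \<Gamma> lab p = \<one>\<^bsub>\<Gamma>\<^esub>"

text \<open>
  A definition cannot quantify over types, so vertices are natural numbers and arcs are pairs of
  natural numbers. Up to isomorphism this covers every complete digraph on \<open>n\<close> vertices.
\<close>
definition balanced_cycle_number :: "('g, 'm) monoid_scheme \<Rightarrow> nat" where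
  "balanced_cycle_number \<Gamma> = (LEAST n. 0 < n \<and>
     (\<forall>(D :: (nat, nat \<times> nat) pre_digraph) lab.
        complete_digraph n D \<and> labelling \<Gamma> D lab \<longrightarrow> (\<exists>p. balanced_cycle \<Gamma> D lab p)))"

end

theory Submission
  imports Defs
begin

text \<open>
  For the upper bound let \<open>K\<close> be an abelian group of odd order and \<open>X\<close> a set of \<open>n \<le> |K| + 1\<close> vertices
  without balanced cycle. Then every \<open>u\<close> has a \<open>v\<close> such that the \<open>u\<close>-\<open>v\<close> paths take at least
  \<open>n - 1\<close> values; for \<open>n = |K| + 1\<close> these are all of \<open>K\<close>, and one of the paths closes up to a balanced
  cycle. The claim is shown by induction on \<open>n\<close>, inside an induction on \<open>|K|\<close>.

  If it fails for \<open>X\<close>, apply it to \<open>X - {w}\<close>: the value set \<open>A w\<close> of the \<open>u\<close>-\<open>w\<close> paths has exactly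
  \<open>n - 2\<close> elements and is the translate of some \<open>A (f w)\<close> by the label of the arc from \<open>f w\<close> to \<open>w\<close>.
  Going around a cycle of \<open>f\<close>, which is not balanced, shows that \<open>A w\<close> has a nontrivial
  stabilizer, hence one of order at least 3 as \<open>|K|\<close> is odd. Applying the claim to \<open>X\<close> minus two
  vertices shows that all \<open>A w\<close> have the same stabilizer \<open>H\<close>. Applying it to \<open>X\<close> minus three vertices
  gives a path value set missing at most two points of a translate of each of the three sets
  \<open>A w\<close>, which forces the cycles on these three vertices to have values in \<open>H\<close>. So on \<open>X - {u}\<close>
  the labels lie in \<open>H\<close> up to a change of gauge, and as \<open>|X - {u}| > |A w| \<ge> |H|\<close> there is a
  balanced cycle by induction on the group.

  For the lower bound, label the forward arcs of a linear order by 0 and the backward arcs by 1: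
  a cycle on at most \<open>q\<close> vertices has at least one and at most \<open>q - 1\<close> backward arcs.
\<close>

section \<open>Translates and stabilizers\<close>

text \<open>Stop at the first index \<open>m\<close> whose value has occurred before; minimality
  makes all earlier values distinct.\<close>

lemma eventually_periodic_orbit:
  assumes "finite S" "f ` S \<subseteq> S" "x \<in> S"
  obtains i k where "0 < k" "(f ^^ (i + k)) x = (f ^^ i) x"
    "inj_on (\<lambda>j. (f ^^ j) x) {i..<i + k}"
proof -
  define y where "y j = (f ^^ j) x" for j
  have "y j \<in> S" for j
    unfolding y_def using assms by (induction j) auto
  then have "\<not> inj y"
    using assms(1) by (meson finite_subset image_subsetI infinite_iff_countable_subset)
  then obtain i j where "i < j" "y i = y j"
    by (metis injI linorder_neqE_nat)
  then have ex: "\<exists>m. \<exists>i<m. y i = y m" by blast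
  define m where "m = (LEAST m. \<exists>i<m. y i = y m)"
  obtain i where i: "i < m" "y i = y m"
    using LeastI_ex[OF ex] unfolding m_def by blast
  have "inj_on y {..<m}"
  proof (rule inj_onI)
    fix a b assume ab: "a \<in> {..<m}" "b \<in> {..<m}" "y a = y b"
    have "\<not> (\<exists>i<n. y i = y n)" if "n < m" for n
      using that not_less_Least unfolding m_def by blast
    with ab show "a = b" by (metis lessThan_iff linorder_neqE_nat)
  qed
  then have "inj_on y {i..<m}" by (rule inj_on_subset) auto
  with i show thesis
    by (intro that[of "m - i" i]) (simp_all add: y_def [abs_def])
qed

context comm_group
begin

fun path_prod :: "('v \<Rightarrow> 'v \<Rightarrow> 'a) \<Rightarrow> 'v list \<Rightarrow> 'a" where
  "path_prod a (x # y # p) = a x y \<otimes> path_prod a (y # p)"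
| "path_prod a _ = \<one>"

text \<open>\<open>p\<close> lists each vertex of the cycle once, so the closing arc is multiplied
  in separately. Diagonal values of \<open>a\<close> never enter, as \<open>p\<close> is distinct of
  length at least 2.\<close>

definition has_balanced_cycle :: "('v \<Rightarrow> 'v \<Rightarrow> 'a) \<Rightarrow> 'v set \<Rightarrow> bool" where
  "has_balanced_cycle a X \<longleftrightarrow>
     (\<exists>p. distinct p \<and> 2 \<le> length p \<and> set p \<subseteq> X \<and> path_prod a p \<otimes> a (last p) (hd p) = \<one>)"

definition path_values :: "('v \<Rightarrow> 'v \<Rightarrow> 'a) \<Rightarrow> 'v set \<Rightarrow> 'v \<Rightarrow> 'v \<Rightarrow> 'a set" where
  "path_values a X u v =
     path_prod a ` {p. p \<noteq> [] \<and> distinct p \<and> set p \<subseteq> X \<and> hd p = u \<and> last p = v}"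

text \<open>Taken inside \<open>K\<close>, because the induction descends through finite subgroups
  of one fixed ambient group.\<close>

definition stab :: "'a set \<Rightarrow> 'a set \<Rightarrow> 'a set" where
  "stab K A = {h \<in> K. A #> h = A}"

lemma r_coset_as_image: "A #> g = (\<lambda>x. x \<otimes> g) ` A"
  by (auto simp: r_coset_def)

lemma card_r_coset:
  assumes "A \<subseteq> carrier G" "g \<in> carrier G"
  shows "card (A #> g) = card A"
  unfolding r_coset_as_image using assms
  by (intro card_image inj_onI) (auto simp: subset_iff)

lemma r_coset_mono: "A \<subseteq> B \<Longrightarrow> A #> g \<subseteq> B #> g"
  by (auto simp: r_coset_def)

lemma subgroup_stab:
  assumes "subgroup K G" "A \<subseteq> carrier G"
  shows "subgroup (stab K A) G"
proof -
  interpret K: subgroup K G by fact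
  show ?thesis
  proof (rule subgroupI)
    show "stab K A \<subseteq> carrier G" by (auto simp: stab_def)
    show "stab K A \<noteq> {}"
      using coset_mult_one[OF assms(2)] subgroup.one_closed[OF assms(1)]
      by (auto simp: stab_def intro!: exI[of _ \<one>])
  next
    fix h assume h: "h \<in> stab K A"
    then have "A #> inv h = A #> h #> inv h" by (simp add: stab_def)
    also have "\<dots> = A"
      using h assms(2) coset_mult_assoc[of A h "inv h"] by (simp add: stab_def)
    finally show "inv h \<in> stab K A" using h by (auto simp: stab_def)
  next
    fix g h assume "g \<in> stab K A" "h \<in> stab K A"
    then show "g \<otimes> h \<in> stab K A"
      using assms(2) by (auto simp: stab_def simp flip: coset_mult_assoc)
  qed
qed

lemma stab_r_coset:
  assumes "subgroup K G" "A \<subseteq> carrier G" "g \<in> carrier G"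
  shows "stab K (A #> g) = stab K A"
proof -
  interpret K: subgroup K G by fact
  have "A #> g #> h = A #> g \<longleftrightarrow> A #> h = A" if "h \<in> K" for h
  proof -
    have "A #> g #> h = A #> h #> g"
      using that assms by (simp add: coset_mult_assoc m_comm)
    moreover have "A #> h #> g #> inv g = A #> h" "A #> g #> inv g = A"
      using that assms by (simp_all add: coset_mult_assoc r_coset_subset_G m_assoc)
    ultimately show ?thesis by metis
  qed
  then show ?thesis by (auto simp: stab_def)
qed

lemma mem_stab_mult:
  assumes "h \<in> stab K A" "x \<in> A"
  shows "x \<otimes> h \<in> A"
  using assms by (auto simp: stab_def r_coset_as_image)

lemma card_stab_le:
  assumes "finite A" "A \<subseteq> carrier G" "A \<noteq> {}" "subgroup K G"
  shows "card (stab K A) \<le> card A"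
proof -
  obtain x where x: "x \<in> A" using assms by blast
  have "stab K A \<subseteq> carrier G"
    using subgroup.subset[OF subgroup_stab[OF assms(4,2)]] .
  then have "inj_on (\<lambda>h. x \<otimes> h) (stab K A)"
    using x assms(2) by (auto intro!: inj_onI simp: subset_iff)
  moreover have "(\<lambda>h. x \<otimes> h) ` stab K A \<subseteq> A"
    using x by (auto intro: mem_stab_mult)
  ultimately show ?thesis using assms(1) by (rule card_inj_on_le)
qed

lemma card_subgroup_dvd:
  assumes "subgroup H G" "subgroup K G" "H \<subseteq> K"
  shows "card H dvd card K"
proof -
  interpret K: group "G\<lparr>carrier := K\<rparr>"
    using assms(2) by (simp add: subgroup_imp_group)
  have "subgroup H (G\<lparr>carrier := K\<rparr>)"
    using assms subgroup_incl by blast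
  from K.lagrange[OF this] show ?thesis
    by (simp add: order_def) (metis dvd_triv_right)
qed

text \<open>
  If \<open>p\<close> lay in \<open>A' - A\<close> then, for fixed \<open>h' \<noteq> \<one>\<close> stabilizing \<open>A'\<close>, the elements \<open>p h h'\<close> with
  \<open>h \<noteq> \<one>\<close> stabilizing \<open>A\<close> would be at least two elements of \<open>A - B\<close>.
\<close>
lemma stable_extensions_by_one_eq:
  assumes K: "subgroup K G"
    and A: "finite A" "A \<subseteq> carrier G" and A': "finite A'" "A' \<subseteq> carrier G"
    and card: "card A' = card A"
    and B: "B \<subseteq> A" "B \<subseteq> A'" "card A \<le> card B + 1"
    and S: "3 \<le> card (stab K A)" and S': "3 \<le> card (stab K A')"
  shows "A = A'"
proof (rule ccontr)
  assume ne: "A \<noteq> A'"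
  have finB: "finite B" using B A finite_subset by blast
  have stabK: "stab K A \<subseteq> carrier G" "stab K A' \<subseteq> carrier G"
    using subgroup.subset[OF subgroup_stab] K A A' by blast+
  have "\<not> A' \<subseteq> A"
    using card_subset_eq[OF A(1)] card ne by metis
  then obtain p where p: "p \<in> A'" "p \<notin> A" by blast
  have pG: "p \<in> carrier G" using p A' by blast
  have pB: "p \<notin> B" using p B by blast
  \<comment> \<open>\<open>B\<close> misses at most one point of \<open>A'\<close>, and
    \<open>p\<close> is such a point.\<close>
  have "card A' \<le> card (insert p B)"
    using B(3) card pB finB by simp
  then have A'eq: "A' = insert p B"
    using card_seteq[OF A'(1), of "insert p B"] p B by auto
  obtain h' where h': "h' \<in> stab K A'" "h' \<noteq> \<one>"
  proof -
    have "\<not> stab K A' \<subseteq> {\<one>}"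
      using S' card_mono[of "{\<one>}" "stab K A'"] by auto
    then show thesis using that by blast
  qed
  have "finite (stab K A)" using S by (rule_tac card_ge_0_finite) simp
  then have "2 \<le> card (stab K A - {\<one>})" using S by (auto simp: card_Diff_singleton_if)
  also have "\<dots> \<le> card (A - B)"
  proof (rule card_inj_on_le)
    show "inj_on (\<lambda>h. p \<otimes> h' \<otimes> h) (stab K A - {\<one>})"
      using stabK h' pG by (intro inj_onI) (auto simp: subset_iff)
    show "(\<lambda>h. p \<otimes> h' \<otimes> h) ` (stab K A - {\<one>}) \<subseteq> A - B"
    proof safe
      fix h assume h: "h \<in> stab K A" "h \<noteq> \<one>"
      have G: "h \<in> carrier G" "h' \<in> carrier G" using stabK h h' by auto
      have "p \<otimes> h' \<noteq> p" using h' G pG by simp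
      then have "p \<otimes> h' \<in> B"
        using mem_stab_mult[OF h'(1) p(1)] A'eq by auto
      then show "p \<otimes> h' \<otimes> h \<in> A"
        using mem_stab_mult[OF h(1)] B by blast
      have inv_h: "inv h \<in> stab K A" "inv h' \<in> stab K A'"
        using subgroup.m_inv_closed[OF subgroup_stab] K A A' h h' by blast+
      \<comment> \<open>The point \<open>p \<otimes> h\<close> is outside \<open>A\<close> and
        differs from \<open>p\<close>, so it is outside \<open>A'\<close>. If
        \<open>p \<otimes> h' \<otimes> h\<close> were in \<open>B\<close>, undoing
        \<open>h'\<close> would put \<open>p \<otimes> h\<close> into \<open>A'\<close>.\<close>
      have "p \<otimes> h \<notin> A"
      proof
        assume "p \<otimes> h \<in> A"
        from mem_stab_mult[OF inv_h(1) this] show False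
          using p pG G by (simp add: m_assoc)
      qed
      moreover have "p \<otimes> h \<noteq> p" using h G pG by simp
      ultimately have nA': "p \<otimes> h \<notin> A'" using A'eq B by auto
      assume "p \<otimes> h' \<otimes> h \<in> B"
      then have "p \<otimes> h' \<otimes> h \<in> A'" using B by auto
      from mem_stab_mult[OF inv_h(2) this] have "p \<otimes> h' \<otimes> h \<otimes> inv h' \<in> A'" .
      moreover have "p \<otimes> h' \<otimes> h \<otimes> inv h' = p \<otimes> h"
        using pG G by (metis inv_closed m_assoc m_closed m_comm r_inv r_one)
      ultimately show False using nA' by simp
    qed
    show "finite (A - B)" using A by simp
  qed
  also have "\<dots> \<le> 1" using B A finB by (simp add: card_Diff_subset)
  finally show False by simp
qed

text \<open>Fewer points are missing from \<open>B\<close> than a coset of the stabilizer has, so every coset in \<open>A\<close> meets \<open>B\<close>.\<close>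
lemma translation_in_stab:
  assumes K: "subgroup K G" and A: "finite A" "A \<subseteq> carrier G"
    and B: "B \<subseteq> A" "card A < card B + card (stab K A)"
    and t: "t \<in> K" "B #> t \<subseteq> A"
  shows "t \<in> stab K A"
proof -
  interpret K: subgroup K G by fact
  interpret S: subgroup "stab K A" G by (rule subgroup_stab[OF K A(2)])
  have finB: "finite B" using B A finite_subset by blast
  have tG: "t \<in> carrier G" using t by simp
  have "A #> t \<subseteq> A"
  proof
    fix z assume "z \<in> A #> t"
    then obtain x where x: "x \<in> A" "z = x \<otimes> t" by (auto simp: r_coset_as_image)
    have xG: "x \<in> carrier G" using x A by blast
    have "\<exists>h\<in>stab K A. x \<otimes> h \<in> B"
    proof (rule ccontr)
      assume "\<not> ?thesis"
      then have sub: "(\<lambda>h. x \<otimes> h) ` stab K A \<subseteq> A - B"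
        using mem_stab_mult x by auto
      have "inj_on (\<lambda>h. x \<otimes> h) (stab K A)"
        using xG by (intro inj_onI) simp
      from card_inj_on_le[OF this sub] A B finB
      have "card (stab K A) \<le> card A - card B" by (simp add: card_Diff_subset)
      with B(2) card_mono[OF A(1) B(1)] show False by simp
    qed
    \<comment> \<open>Slide \<open>x\<close> along its stabilizer coset into \<open>B\<close>,
      translate by \<open>t\<close>, and slide back by \<open>inv h\<close>.\<close>
    then obtain h where h: "h \<in> stab K A" "x \<otimes> h \<in> B" by blast
    then have "x \<otimes> h \<otimes> t \<in> A" using t by (auto simp: r_coset_as_image)
    then have "x \<otimes> h \<otimes> t \<otimes> inv h \<in> A"
      using h by (auto intro: mem_stab_mult)
    moreover have "x \<otimes> h \<otimes> t \<otimes> inv h = x \<otimes> t"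
      using xG tG h by (metis S.mem_carrier inv_closed m_assoc m_closed m_comm r_inv r_one)
    ultimately show "z \<in> A" using x by simp
  qed
  then have "A #> t = A"
    using A tG by (metis card_r_coset card_subset_eq)
  with t show ?thesis by (simp add: stab_def)
qed

section \<open>Values of paths\<close>

lemma path_prod_closed:
  assumes "subgroup K G" "\<And>x y. a x y \<in> K"
  shows "path_prod a p \<in> K"
  using assms by (induction a p rule: path_prod.induct)
    (auto intro: subgroup.m_closed subgroup.one_closed)

lemma path_prod_snoc:
  assumes "\<And>x y. a x y \<in> carrier G" "p \<noteq> []"
  shows "path_prod a (p @ [w]) = path_prod a p \<otimes> a (last p) w"
  using assms(2)
proof (induction p rule: induct_list012)
  case (3 x y zs)
  have "path_prod a (y # zs) \<in> carrier G"
    by (rule path_prod_closed[OF subgroup_self]) (rule assms)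
  with 3 assms(1) show ?case by (auto simp: m_assoc)
qed (use assms in auto)

lemma path_values_subset:
  assumes "subgroup K G" "\<And>x y. a x y \<in> K"
  shows "path_values a X u v \<subseteq> K"
  using path_prod_closed[OF assms] by (auto simp: path_values_def)

lemma path_values_mono: "X \<subseteq> Y \<Longrightarrow> path_values a X u v \<subseteq> path_values a Y u v"
  by (auto simp: path_values_def)

text \<open>Since \<open>w\<close> is outside \<open>X\<close>, appending it to a path in
  \<open>X\<close> creates no repeated vertex.\<close>

lemma path_values_extend:
  assumes "\<And>x y. a x y \<in> carrier G" "w \<notin> X" "w \<in> Y" "X \<subseteq> Y"
  shows "path_values a X u v #> a v w \<subseteq> path_values a Y u w"
proof
  fix z assume "z \<in> path_values a X u v #> a v w"
  then obtain p where p: "p \<noteq> []" "distinct p" "set p \<subseteq> X" "hd p = u" "last p = v"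
    "z = path_prod a p \<otimes> a v w"
    by (auto simp: path_values_def r_coset_as_image)
  then have "z = path_prod a (p @ [w])" by (simp add: path_prod_snoc assms)
  then show "z \<in> path_values a Y u w"
    using p assms by (auto simp: path_values_def intro!: image_eqI[where x = "p @ [w]"])
qed

lemma has_balanced_cycle_mono:
  "has_balanced_cycle a X \<Longrightarrow> X \<subseteq> Y \<Longrightarrow> has_balanced_cycle a Y"
  by (auto simp: has_balanced_cycle_def)

section \<open>Change of gauge\<close>

lemma telescope:
  assumes "g \<in> carrier G" "x \<in> carrier G" "h \<in> carrier G" "y \<in> carrier G" "k \<in> carrier G"
  shows "g \<otimes> x \<otimes> inv h \<otimes> (h \<otimes> y \<otimes> inv k) = g \<otimes> (x \<otimes> y) \<otimes> inv k"
proof -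
  have "g \<otimes> x \<otimes> inv h \<otimes> (h \<otimes> y \<otimes> inv k) = g \<otimes> x \<otimes> (inv h \<otimes> h) \<otimes> y \<otimes> inv k"
    using assms by (simp only: m_assoc m_closed inv_closed)
  then show ?thesis using assms by (simp add: m_assoc)
qed

lemma conjugate_eq:
  assumes "g \<in> carrier G" "x \<in> carrier G"
  shows "g \<otimes> x \<otimes> inv g = x"
  using assms by (simp add: m_comm[of g] m_assoc)

text \<open>The potentials cancel at the inner vertices of a path, and the closing arc cancels the
  two left at its ends; so \<open>a\<close> and \<open>b\<close> give every cycle in
  \<open>X\<close> the same value.\<close>

lemma has_balanced_cycle_gauge:
  assumes a: "\<And>x y. a x y \<in> carrier G" and \<pi>: "\<And>x. \<pi> x \<in> carrier G"
    and b: "\<And>x y. x \<in> X \<Longrightarrow> y \<in> X \<Longrightarrow> x \<noteq> y \<Longrightarrow> b x y = \<pi> x \<otimes> a x y \<otimes> inv (\<pi> y)"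
    and cyc: "has_balanced_cycle b X"
  shows "has_balanced_cycle a X"
proof -
  have aG: "path_prod a p \<in> carrier G" for p
    by (rule path_prod_closed[OF subgroup_self a])
  have gauge: "path_prod b p = \<pi> (hd p) \<otimes> path_prod a p \<otimes> inv (\<pi> (last p))"
    if "p \<noteq> []" "distinct p" "set p \<subseteq> X" for p
    using that
  proof (induction p rule: induct_list012)
    case (3 x y zs)
    let ?g = "\<pi> (last (y # zs))" and ?c = "path_prod a (y # zs)"
    have "path_prod b (x # y # zs) = \<pi> x \<otimes> a x y \<otimes> inv (\<pi> y) \<otimes> (\<pi> y \<otimes> ?c \<otimes> inv ?g)"
      using 3 b by auto
    also have "\<dots> = \<pi> x \<otimes> (a x y \<otimes> ?c) \<otimes> inv ?g"
      by (intro telescope a \<pi> aG)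
    finally show ?case by simp
  qed (use \<pi> in auto)
  obtain p where p: "distinct p" "2 \<le> length p" "set p \<subseteq> X"
    "path_prod b p \<otimes> b (last p) (hd p) = \<one>"
    using cyc by (auto simp: has_balanced_cycle_def)
  have "p \<noteq> []" "last p \<noteq> hd p"
    using p by (cases p; auto)+
  then have "\<one> = \<pi> (hd p) \<otimes> path_prod a p \<otimes> inv (\<pi> (last p)) \<otimes>
      (\<pi> (last p) \<otimes> a (last p) (hd p) \<otimes> inv (\<pi> (hd p)))"
    using p b[of "last p" "hd p"] gauge[of p] by (auto simp: subset_iff)
  also have "\<dots> = path_prod a p \<otimes> a (last p) (hd p)"
    using a \<pi> aG by (simp add: telescope conjugate_eq)
  finally have "path_prod a p \<otimes> a (last p) (hd p) = \<one>" by simp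
  with p show ?thesis by (auto simp: has_balanced_cycle_def)
qed

section \<open>Abelian groups of odd order\<close>

text \<open>Iterating \<open>f\<close> from \<open>w\<close> runs into a cycle, whose value
  stabilizes the sets \<open>A\<close> on it and is not \<open>\<one>\<close>. Translates have equal
  stabilizers, so this passes to \<open>A w\<close>.\<close>

lemma stab_nontrivial_if_translate_cycle:
  assumes K: "subgroup K G" and a: "\<And>x y. a x y \<in> K"
    and W: "finite W" "f ` W \<subseteq> W" "\<And>w. w \<in> W \<Longrightarrow> f w \<noteq> w"
    and A: "\<And>w. w \<in> W \<Longrightarrow> A w \<subseteq> carrier G"
    and step: "\<And>w. w \<in> W \<Longrightarrow> A w = A (f w) #> a (f w) w"
    and nocyc: "\<not> has_balanced_cycle a W" and w: "w \<in> W"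
  shows "\<exists>s\<in>stab K (A w). s \<noteq> \<one>"
proof -
  interpret K: subgroup K G by fact
  obtain i k where k: "0 < k" "(f ^^ (i + k)) w = (f ^^ i) w"
    "inj_on (\<lambda>j. (f ^^ j) w) {i..<i + k}"
    by (rule eventually_periodic_orbit[OF W(1,2) w])
  define y where "y j = (f ^^ j) w" for j
  \<comment> \<open>The orbit is listed backwards, since \<open>step\<close> uses the arc from
    \<open>f w\<close> to \<open>w\<close>.\<close>
  define P where "P j l = map y (rev [j..<Suc (j + l)])" for j l
  have yW: "y j \<in> W" for j
    unfolding y_def using W(2) w by (induction j) auto
  have PK: "path_prod a (P j l) \<in> K" for j l
    by (rule path_prod_closed[OF K a])
  have A_y: "A (y j) = A (y (j + l)) #> path_prod a (P j l)" for j l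
  proof (induction l)
    case 0
    show ?case using A[OF yW] by (simp add: P_def coset_mult_one)
  next
    case (Suc l)
    have "P j (Suc l) = y (Suc (j + l)) # y (j + l) # map y (rev [j..<j + l])"
      "P j l = y (j + l) # map y (rev [j..<j + l])"
      by (simp_all add: P_def)
    then have "path_prod a (P j (Suc l)) = a (y (Suc (j + l))) (y (j + l)) \<otimes> path_prod a (P j l)"
      by simp
    moreover have "A (y (j + l)) = A (y (Suc (j + l))) #> a (y (Suc (j + l))) (y (j + l))"
      using step[OF yW[of "j + l"]] by (simp add: y_def)
    ultimately show ?case
      using Suc A[OF yW] a PK by (simp add: coset_mult_assoc)
  qed
  define p where "p = map y (rev [i..<i + k])"
  define s where "s = path_prod a (P i k)"
  \<comment> \<open>Absence of fixed points rules out period 1, so the cycle has length at least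
    2.\<close>
  have "y (Suc i) \<noteq> y i"
    using W(3)[OF yW[of i]] by (simp add: y_def)
  then have "k \<noteq> 1" using k(2) by (auto simp: y_def)
  with k(1) have k2: "2 \<le> k" by simp
  obtain k' where k': "k = Suc k'" using k(1) by (cases k) auto
  have hd_last: "hd p = y (i + k')" "last p = y i"
    by (simp_all add: p_def k' last_map last_rev hd_append)
  \<comment> \<open>\<open>P i k\<close> is \<open>p\<close> preceded by
    \<open>y (i + k) = y i\<close>; commutativity moves this closing arc to the end.\<close>
  have "s = a (y i) (hd p) \<otimes> path_prod a p"
    using k(2) unfolding s_def P_def p_def k' by (simp add: y_def)
  also have "\<dots> = path_prod a p \<otimes> a (last p) (hd p)"
    using a path_prod_closed[where a = a, OF K a] by (simp add: hd_last m_comm)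
  finally have s: "s = path_prod a p \<otimes> a (last p) (hd p)" .
  have "distinct p" using k(3) by (simp add: p_def distinct_map y_def[abs_def])
  moreover have "2 \<le> length p" "set p \<subseteq> W" using k2 yW by (auto simp: p_def)
  ultimately have "s \<noteq> \<one>"
    using nocyc s unfolding has_balanced_cycle_def by metis
  moreover have "s \<in> stab K (A (y i))"
    using A_y[of i k] k(2) PK by (simp add: stab_def s_def y_def)
  moreover have "A w = A (y i) #> path_prod a (P 0 i)"
    using A_y[of 0 i] by (simp add: y_def)
  ultimately show ?thesis
    using stab_r_coset[OF K A[OF yW[of i]]] PK by (metis K.mem_carrier)
qed

text \<open>This is the inner induction, on \<open>card X\<close>. \<open>IH\<close> is the outer
  induction hypothesis on the group, applied at the end to the common stabilizer.\<close>

lemma many_path_values: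
  assumes K: "subgroup K G" "finite K" "odd (card K)"
    and IH: "\<And>H b (Y :: 'v set). \<lbrakk>subgroup H G; H \<subseteq> K; card H < card K;
       \<And>x y. b x y \<in> H; finite Y; card H < card Y\<rbrakk> \<Longrightarrow> has_balanced_cycle b Y"
    and a: "\<And>x y. a x y \<in> K"
    and X: "finite (X :: 'v set)" "2 \<le> card X" "card X \<le> card K + 1"
    and nocyc: "\<not> has_balanced_cycle a X" and u: "u \<in> X"
  shows "\<exists>v\<in>X - {u}. card X \<le> card (path_values a X u v) + 1"
  using X nocyc u
proof (induction "card X" arbitrary: X rule: less_induct)
  case less
  interpret K: subgroup K G by fact
  have aG: "a x y \<in> carrier G" for x y using a by auto
  note pv_K = path_values_subset[where a = a, OF K(1) a]
  have pv_G: "path_values a Y u v \<subseteq> carrier G" for Y v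
    using pv_K[of Y u v] K.subset by (rule subset_trans)
  have pv_fin: "finite (path_values a Y u v)" for Y v
    using pv_K[of Y u v] K(2) by (rule finite_subset)
  show ?case
  proof (rule ccontr)
    assume contra: "\<not> ?thesis"
    define W where "W = X - {u}"
    define A where "A = path_values a X u"
    have finW: "finite W" and cardW: "card W + 1 = card X"
      using less.prems card_Suc_Diff1[of X u] by (simp_all add: W_def)
    have A_le: "card (A w) + 2 \<le> card X" if "w \<in> W" for w
      using contra that by (force simp: A_def W_def)
    have AG: "A w \<subseteq> carrier G" and finA: "finite (A w)" for w
      unfolding A_def by (rule pv_G, rule pv_fin)
    \<comment> \<open>The induction hypothesis for \<open>X - Z\<close>; the side condition on
      \<open>card Z\<close> leaves at least two vertices.\<close>
    have smaller: "\<exists>v\<in>W - Z. card X \<le> card (path_values a (X - Z) u v) + 1 + card Z"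
      if Z: "Z \<noteq> {}" "Z \<subseteq> W" "card Z + 2 \<le> card X" for Z
    proof -
      have finZ: "finite Z" and ZX: "Z \<subseteq> X" using Z finW finite_subset by (auto simp: W_def)
      have c: "card (X - Z) = card X - card Z" by (rule card_Diff_subset[OF finZ ZX])
      have "card Z > 0" using Z finZ by (simp add: card_gt_0_iff)
      then have "\<exists>v\<in>X - Z - {u}. card (X - Z) \<le> card (path_values a (X - Z) u v) + 1"
        using c Z less.prems has_balanced_cycle_mono[of a "X - Z" X]
        by (intro less.hyps) (auto simp: W_def)
      then show ?thesis using c Z(3) by (force simp: W_def)
    qed
    have ext: "path_values a (X - Z) u v #> a v w \<subseteq> A w" if "w \<in> Z" "Z \<subseteq> W" for Z v w
      unfolding A_def using that by (intro path_values_extend aG) (auto simp: W_def)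
    \<comment> \<open>A path avoiding \<open>Z\<close> may reach \<open>w\<close> by a detour
      through \<open>y\<close>; comparison with the direct arc will give translations.\<close>
    have ext2: "path_values a (X - Z) u v #> a v y #> a y w \<subseteq> A w"
      if "w \<in> Z" "y \<in> Z" "w \<noteq> y" "Z \<subseteq> W" for Z v w y
    proof -
      have "path_values a (X - Z) u v #> a v y \<subseteq> path_values a (X - {w}) u y"
        using that by (intro path_values_extend aG) (auto simp: W_def)
      from r_coset_mono[OF this] show ?thesis
        using ext[of w "{w}"] that by blast
    qed
    \<comment> \<open>With only two vertices, the single arc from \<open>u\<close> already provides
      the one value required.\<close>
    have X3: "3 \<le> card X"
    proof (rule ccontr)
      assume "\<not> ?thesis"
      then have "card W = 1" using cardW less.prems by simp
      then obtain v where v: "W = {v}" by (auto simp: card_1_singleton_iff)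
      then have "path_prod a [u, v] \<in> A v"
        unfolding A_def path_values_def using less.prems by (intro imageI) (auto simp: W_def)
      then have "card (A v) > 0" using finA by (auto simp: card_gt_0_iff)
      then show False using A_le[of v] v cardW by simp
    qed
    \<comment> \<open>Sandwich: \<open>?B\<close> has at least \<open>card X - 2\<close> elements,
      whereas \<open>A v\<close> and \<open>A w\<close> have at most that many. So both inclusions,
      of \<open>?B\<close> in \<open>A v\<close> and of its translate in \<open>A w\<close>, are
      equalities.\<close>
    have "\<forall>w\<in>W. \<exists>v\<in>W - {w}. A w = A v #> a v w \<and> card X = card (A w) + 2"
    proof
      fix w assume w: "w \<in> W"
      obtain v where v: "v \<in> W - {w}" "card X \<le> card (path_values a (X - {w}) u v) + 2"
        using smaller[of "{w}"] w X3 by auto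
      let ?B = "path_values a (X - {w}) u v"
      have "?B \<subseteq> A v" unfolding A_def by (rule path_values_mono) auto
      moreover have "card (A v) \<le> card ?B" using A_le[of v] v by simp
      ultimately have B: "?B = A v" using finA card_seteq by blast
      have "A v #> a v w \<subseteq> A w" using ext[of w "{w}" v] w B by simp
      moreover have "card (A w) \<le> card (A v #> a v w)"
        using A_le[OF w] v(2) B card_r_coset[OF AG aG] by simp
      ultimately have "A v #> a v w = A w" using finA card_seteq by blast
      moreover have "card X = card (A w) + 2"
        using A_le[OF w] v(2) B card_r_coset[OF AG aG, of v v w] \<open>A v #> a v w = A w\<close> by simp
      ultimately show "\<exists>v\<in>W - {w}. A w = A v #> a v w \<and> card X = card (A w) + 2"
        using v by blast
    qed
    then obtain f where f: "\<And>w. w \<in> W \<Longrightarrow> f w \<in> W - {w}"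
      "\<And>w. w \<in> W \<Longrightarrow> A w = A (f w) #> a (f w) w"
      and cardA: "\<And>w. w \<in> W \<Longrightarrow> card X = card (A w) + 2"
      by metis
    have "\<not> has_balanced_cycle a W"
      using less.prems has_balanced_cycle_mono[of a W X] by (auto simp: W_def)
    moreover have "f ` W \<subseteq> W" "\<And>w. w \<in> W \<Longrightarrow> f w \<noteq> w" using f(1) by auto
    ultimately have nontriv: "\<exists>s\<in>stab K (A w). s \<noteq> \<one>" if "w \<in> W" for w
      using stab_nontrivial_if_translate_cycle[where a = a and A = A and f = f, OF K(1) a finW _ _ AG f(2)]
        that by blast
    have stabK: "stab K (A w) \<subseteq> K" and subgrp: "subgroup (stab K (A w)) G" for w
      using subgroup_stab[OF K(1) AG] by (auto simp: stab_def)
    have stab3: "3 \<le> card (stab K (A w))" if "w \<in> W" for w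
    proof -
      have fin: "finite (stab K (A w))" using stabK K(2) finite_subset by blast
      obtain s where s: "s \<in> stab K (A w)" "s \<noteq> \<one>" using nontriv[OF \<open>w \<in> W\<close>] by blast
      have "card {\<one>, s} \<le> card (stab K (A w))"
        using s subgroup.one_closed[OF subgrp] fin by (intro card_mono) auto
      then have "2 \<le> card (stab K (A w))" using s by simp
      moreover have "odd (card (stab K (A w)))"
        using card_subgroup_dvd[OF subgrp K(1) stabK] K(3) dvd_trans by blast
      ultimately show ?thesis by (cases "card (stab K (A w)) = 2") auto
    qed
    have stab_le: "card (stab K (A w)) + 2 \<le> card X" if "w \<in> W" for w
      using card_stab_le[OF finA AG _ K(1)] cardA[OF that] X3
      by (cases "A w = {}") auto
    have W_ne: "W \<noteq> {}" using cardW X3 by auto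
    \<comment> \<open>This leaves room to delete three vertices by \<open>smaller\<close>.\<close>
    then have X5: "5 \<le> card X" using stab_le stab3 by fastforce
    \<comment> \<open>Undoing the last arc places one set of path values inside translates of all
      \<open>A w\<close> with \<open>w\<close> in \<open>Z\<close> simultaneously.\<close>
    have ext_inv: "path_values a (X - Z) u v \<subseteq> A w #> inv a v w" if "w \<in> Z" "Z \<subseteq> W" for Z v w
      using r_coset_mono[OF ext[OF that, of v], of "inv a v w"] pv_G[of "X - Z" v] aG
      by (simp add: coset_mult_assoc coset_mult_one)
    have cG: "A w #> inv a v w \<subseteq> carrier G" and cfin: "finite (A w #> inv a v w)"
      and ccard: "card (A w #> inv a v w) = card (A w)"
      and cstab: "stab K (A w #> inv a v w) = stab K (A w)" for v w
      using AG aG finA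
      by (auto simp: r_coset_subset_G card_r_coset stab_r_coset[OF K(1)]) (simp add: r_coset_as_image)
    have stab_eq: "stab K (A w) = stab K (A y)" if wy: "w \<in> W" "y \<in> W" for w y
    proof (cases "w = y")
      case False
      obtain v where v: "v \<in> W - {w, y}"
        "card X \<le> card (path_values a (X - {w, y}) u v) + 1 + 2"
      proof -
        have "card {w, y} = 2" using False by simp
        then show thesis using smaller[of "{w, y}"] wy X5 that by auto
      qed
      let ?B = "path_values a (X - {w, y}) u v"
      \<comment> \<open>Each translate has \<open>card X - 2\<close> elements and \<open>?B\<close>
        at least \<open>card X - 3\<close>.\<close>
      have "A w #> inv a v w = A y #> inv a v y"
      proof (rule stable_extensions_by_one_eq[OF K(1) cfin cG cfin cG])
        show "?B \<subseteq> A w #> inv a v w" "?B \<subseteq> A y #> inv a v y"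
          by (rule ext_inv; use wy in simp)+
        have "card (A w) = card (A y)" "card (A w) \<le> card ?B + 1"
          using cardA[OF wy(1)] cardA[OF wy(2)] v(2) by simp_all
        then show "card (A y #> inv a v y) = card (A w #> inv a v w)"
          "card (A w #> inv a v w) \<le> card ?B + 1"
          by (simp_all only: ccard)
      qed (simp_all only: cstab stab3 wy)
      then have "stab K (A w #> inv a v w) = stab K (A y #> inv a v y)" by simp
      then show ?thesis by (simp only: cstab)
    qed simp
    obtain r where r: "r \<in> W" using W_ne by blast
    define H where "H = stab K (A r)"
    interpret H: subgroup H G unfolding H_def by (rule subgrp)
    have H: "stab K (A w) = H" if "w \<in> W" for w unfolding H_def by (rule stab_eq[OF that r])
    \<comment> \<open>\<open>?B\<close> misses at most two points of \<open>?C\<close>, fewer than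
      its stabilizer has elements. The detour through \<open>y\<close>, compared with the direct
      arc, translates \<open>?B\<close> into \<open>?C\<close>.\<close>
    have three: "\<exists>v. \<forall>y\<in>Z. \<forall>w\<in>Z. y \<noteq> w \<longrightarrow> a v y \<otimes> a y w \<otimes> inv a v w \<in> H"
      if Z: "Z \<noteq> {}" "Z \<subseteq> W" "card Z \<le> 3" for Z
    proof -
      obtain v where v: "v \<in> W - Z" "card X \<le> card (path_values a (X - Z) u v) + 1 + card Z"
        using smaller[of Z] Z X5 by auto
      let ?B = "path_values a (X - Z) u v"
      have "a v y \<otimes> a y w \<otimes> inv a v w \<in> H" if yw: "y \<in> Z" "w \<in> Z" "y \<noteq> w" for y w
      proof -
        let ?C = "A w #> inv a v w"
        have wW: "w \<in> W" using yw Z by blast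
        have "a v y \<otimes> a y w \<otimes> inv a v w \<in> stab K ?C"
        proof (rule translation_in_stab[OF K(1) cfin cG])
          show "?B \<subseteq> ?C" using yw Z by (intro ext_inv)
          show "card ?C < card ?B + card (stab K ?C)"
            using v Z cardA[OF wW] stab3[OF wW] by (simp add: ccard cstab)
          show "a v y \<otimes> a y w \<otimes> inv a v w \<in> K" using a by auto
          show "?B #> a v y \<otimes> a y w \<otimes> inv a v w \<subseteq> ?C"
            using r_coset_mono[OF ext2[of w Z y v], of "inv a v w"] yw Z pv_G aG
            by (simp add: coset_mult_assoc m_assoc)
        qed
        then show ?thesis by (simp only: H[OF wW] cstab)
      qed
      then show ?thesis by blast
    qed
    \<comment> \<open>Gauge based at \<open>r\<close>. Setting \<open>b\<close> to
      \<open>\<one>\<close> off the relevant pairs makes it \<open>H\<close>-valued everywhere, as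
      \<open>IH\<close> demands.\<close>
    define \<pi> where "\<pi> x = (if x = r then \<one> else a r x)" for x
    define b where "b x y = (if x \<in> W \<and> y \<in> W \<and> x \<noteq> y then \<pi> x \<otimes> a x y \<otimes> inv (\<pi> y) else \<one>)" for x y
    have "b x y \<in> H" for x y
    proof (cases "x \<in> W \<and> y \<in> W \<and> x \<noteq> y")
      case True
      then have xy: "x \<in> W" "y \<in> W" "x \<noteq> y" by simp_all
      \<comment> \<open>\<open>r\<close> may coincide with \<open>x\<close> or \<open>y\<close>,
        hence the bound \<open>card Z \<le> 3\<close> in \<open>three\<close> instead of
        equality.\<close>
      obtain v where v: "\<forall>x'\<in>{r, x, y}. \<forall>y'\<in>{r, x, y}. x' \<noteq> y' \<longrightarrow>
          a v x' \<otimes> a x' y' \<otimes> inv a v y' \<in> H"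
      proof -
        have "card {r, x, y} \<le> 3" by (simp add: card_insert_if)
        then have "\<exists>v. \<forall>x'\<in>{r, x, y}. \<forall>y'\<in>{r, x, y}. x' \<noteq> y' \<longrightarrow>
            a v x' \<otimes> a x' y' \<otimes> inv a v y' \<in> H"
          using r xy by (intro three) simp_all
        then show thesis using that by (elim exE)
      qed
      \<comment> \<open>These are the labels in the gauge based at \<open>v\<close>. In the products
        below the labels of arcs leaving \<open>v\<close> cancel, which gives the gauge based at
        \<open>r\<close>.\<close>
      define c where "c x' y' = a v x' \<otimes> a x' y' \<otimes> inv a v y'" for x' y'
      have cH: "c x' y' \<in> H" if "x' \<in> {r, x, y}" "y' \<in> {r, x, y}" "x' \<noteq> y'" for x' y'
        unfolding c_def using v that by blast
      consider "x = r" | "y = r" | "x \<noteq> r" "y \<noteq> r" by blast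
      then have "\<pi> x \<otimes> a x y \<otimes> inv (\<pi> y) \<in> H"
      proof cases
        case 1
        with xy show ?thesis using aG by (simp add: \<pi>_def)
      next
        case 2
        have "c r x \<otimes> c x r = a r x \<otimes> a x r"
          using aG by (simp add: c_def telescope conjugate_eq)
        moreover have "c r x \<in> H" "c x r \<in> H" using cH 2 xy by auto
        ultimately have "a r x \<otimes> a x r \<in> H" by (metis H.m_closed)
        with 2 xy show ?thesis using aG by (simp add: \<pi>_def)
      next
        case 3
        have "inv (c r y) = a v y \<otimes> inv (a r y) \<otimes> inv (a v r)"
          using aG by (simp add: c_def inv_mult_group m_assoc)
        then have "c r x \<otimes> c x y \<otimes> inv (c r y) = a r x \<otimes> a x y \<otimes> inv (a r y)"
          using aG by (simp add: c_def telescope conjugate_eq)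
        moreover have "c r x \<in> H" "c x y \<in> H" "c r y \<in> H" using cH xy 3 by auto
        ultimately have "a r x \<otimes> a x y \<otimes> inv (a r y) \<in> H"
          by (metis H.m_closed H.m_inv_closed)
        with 3 show ?thesis by (simp add: \<pi>_def)
      qed
      with True show ?thesis by (simp add: b_def)
    qed (auto simp: b_def)
    \<comment> \<open>With \<open>card X \<le> card K + 1\<close> this makes \<open>H\<close> a
      proper subgroup, and with \<open>card W + 1 = card X\<close> it gives
      \<open>card H < card W\<close>.\<close>
    moreover have "card H + 2 \<le> card X" using stab_le[OF r] by (simp add: H_def)
    ultimately have "has_balanced_cycle b W"
      using cardW less.prems stabK finW by (intro IH[of H] H.subgroup_axioms) (auto simp: H_def)
    then have "has_balanced_cycle a W"
      by (rule has_balanced_cycle_gauge[rotated -1]) (auto simp: b_def \<pi>_def aG)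
    then show False
      using less.prems has_balanced_cycle_mono[of a W X] by (auto simp: W_def)
  qed
qed

text \<open>On \<open>card K + 1\<close> vertices the paths from \<open>u\<close> to some
  \<open>v\<close> take all values in \<open>K\<close>, including the inverse of the label of the
  arc back. Subgroups of a fixed group let the induction reach stabilizers.\<close>

theorem odd_subgroup_has_balanced_cycle:
  assumes "subgroup K G" "finite K" "odd (card K)"
    and "\<And>x y. a x y \<in> K" and "finite (X :: 'v set)" "card K < card X"
  shows "has_balanced_cycle a X"
  using assms
proof (induction "card K" arbitrary: K a X rule: less_induct)
  case less
  interpret K: subgroup K G by fact
  obtain Y where Y: "Y \<subseteq> X" "card Y = card K + 1" "finite Y"
    using obtain_subset_with_card_n[of "card K + 1" X] less.prems by auto
  have "card K > 0" using less.prems by (auto simp: card_gt_0_iff)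
  then have Y2: "2 \<le> card Y" "Y \<noteq> {}" using Y by auto
  then obtain u where u: "u \<in> Y" by blast
  have "has_balanced_cycle a Y"
  proof (rule ccontr)
    assume no: "\<not> has_balanced_cycle a Y"
    have IH: "has_balanced_cycle b Z"
      if "subgroup H G" "H \<subseteq> K" "card H < card K" "\<And>x y. b x y \<in> H" "finite Z" "card H < card Z"
      for H b and Z :: "'v set"
    proof (rule less.hyps[OF that(3,1)])
      show "finite H" using that less.prems(2) finite_subset by blast
      show "odd (card H)"
        using card_subgroup_dvd[OF that(1) less.prems(1) that(2)] less.prems(3) dvd_trans by blast
    qed (fact that)+
    have "\<exists>v\<in>Y - {u}. card Y \<le> card (path_values a Y u v) + 1"
    proof (rule many_path_values[OF less.prems(1-3)])
      show "card Y \<le> card K + 1" using Y by simp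
    qed (fact IH less.prems Y Y2 no u)+
    with Y
    obtain v where v: "v \<in> Y" "v \<noteq> u" "card K \<le> card (path_values a Y u v)" by auto
    then have "path_values a Y u v = K"
      using card_seteq[OF less.prems(2) path_values_subset[where a = a, OF less.prems(1,4)]]
      by blast
    then have "inv (a v u) \<in> path_values a Y u v" using less.prems by auto
    then obtain p where p: "p \<noteq> []" "distinct p" "set p \<subseteq> Y" "hd p = u" "last p = v"
      "inv (a v u) = path_prod a p"
      by (auto simp: path_values_def)
    have "2 \<le> length p" using p v by (cases p; cases "tl p"; auto)
    moreover have "path_prod a p \<otimes> a (last p) (hd p) = \<one>"
      using p less.prems by (metis K.mem_carrier l_inv)
    ultimately show False using p no by (auto simp: has_balanced_cycle_def)
  qed
  then show ?case using Y has_balanced_cycle_mono by blast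
qed

end

section \<open>Complete digraphs\<close>

text \<open>Used with \<open><\<close> and \<open>>\<close>: a closed walk can be neither strictly
  increasing nor strictly decreasing.\<close>

lemma (in pre_digraph) trans_along_walk:
  assumes "cas u p v" "p \<noteq> []" "transp R" "\<And>e. e \<in> set p \<Longrightarrow> R (tail G e) (head G e)"
  shows "R u v"
  using assms
proof (induction p arbitrary: u)
  case (Cons e p)
  show ?case
  proof (cases "p = []")
    case False
    then have "R (head G e) v" using Cons by auto
    moreover have "R u (head G e)" using Cons.prems by auto
    ultimately show ?thesis using Cons.prems(3) by (blast dest: transpD)
  qed (use Cons.prems in auto)
qed simp

text \<open>Choosing an arc \<open>e x y\<close> for each ordered pair turns \<open>lab\<close> into
  a function of two vertices, and vertex lists into arc walks.\<close>

theorem complete_digraph_has_balanced_cycle: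
  assumes "comm_group \<Gamma>" "finite (carrier \<Gamma>)" "odd (card (carrier \<Gamma>))"
    and D: "complete_digraph n D" and n: "card (carrier \<Gamma>) < n" and lab: "labelling \<Gamma> D lab"
  shows "\<exists>p. balanced_cycle \<Gamma> D lab p"
proof -
  interpret comm_group \<Gamma> by fact
  interpret D: graph D using D by (simp add: complete_digraph_def)
  have "\<exists>e\<in>arcs D. tail D e = x \<and> head D e = y" if "x \<in> verts D" "y \<in> verts D" "x \<noteq> y" for x y
  proof -
    have "(x, y) \<in> arcs_ends D" using that D by (auto simp: complete_digraph_def)
    then show ?thesis by (auto simp: arcs_ends_conv)
  qed
  then obtain e where e: "\<And>x y. x \<in> verts D \<Longrightarrow> y \<in> verts D \<Longrightarrow> x \<noteq> y \<Longrightarrow>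
      e x y \<in> arcs D \<and> tail D (e x y) = x \<and> head D (e x y) = y"
    by metis
  define a where "a x y = (if x \<in> verts D \<and> y \<in> verts D \<and> x \<noteq> y then lab (e x y) else \<one>\<^bsub>\<Gamma>\<^esub>)" for x y
  have a: "a x y \<in> carrier \<Gamma>" for x y
    using e lab by (auto simp: a_def labelling_def)
  define walk where "walk p z = map2 e p (tl p @ [z])" for p z
  \<comment> \<open>Only \<open>last p \<noteq> z\<close> is assumed of \<open>z\<close>, so that
    \<open>z = hd p\<close> is allowed and closes the walk.\<close>
  have walk: "set (walk p z) \<subseteq> arcs D \<and> D.cas (hd p) (walk p z) z \<and>
      D.awalk_verts u (walk p z) = p @ [z] \<and>
      walk_label \<Gamma> lab (walk p z) = path_prod a p \<otimes>\<^bsub>\<Gamma>\<^esub> a (last p) z"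
    if "p \<noteq> []" "distinct p" "last p \<noteq> z" "set p \<subseteq> verts D" "z \<in> verts D" for p z u
    using that
  proof (induction p arbitrary: u rule: induct_list012)
    case (2 x)
    have "a x z \<in> carrier \<Gamma>" by (rule a)
    with 2 show ?case using e[of x z] by (simp add: walk_def walk_label_def a_def)
  next
    case (3 x y p)
    have IH: "set (walk (y # p) z) \<subseteq> arcs D \<and> D.cas (hd (y # p)) (walk (y # p) z) z \<and>
      D.awalk_verts y (walk (y # p) z) = (y # p) @ [z] \<and>
      walk_label \<Gamma> lab (walk (y # p) z) = path_prod a (y # p) \<otimes>\<^bsub>\<Gamma>\<^esub> a (last (y # p)) z"
      using 3 by (intro "3.IH") auto
    have "walk (x # y # p) z = e x y # walk (y # p) z" by (simp add: walk_def)
    moreover have "e x y \<in> arcs D" "tail D (e x y) = x" "head D (e x y) = y" "a x y = lab (e x y)"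
      using e[of x y] 3 by (auto simp: a_def)
    moreover have "path_prod a (y # p) \<in> carrier \<Gamma>"
      by (rule path_prod_closed[OF subgroup_self a])
    moreover have "lab (e x y) \<in> carrier \<Gamma>" using a[of x y] \<open>a x y = lab (e x y)\<close> by simp
    ultimately show ?case using IH a by (simp add: walk_label_def m_assoc)
  qed simp
  have "has_balanced_cycle a (verts D)"
    using assms a by (intro odd_subgroup_has_balanced_cycle[OF subgroup_self])
      (auto simp: complete_digraph_def)
  then obtain p where p: "distinct p" "2 \<le> length p" "set p \<subseteq> verts D"
    "path_prod a p \<otimes>\<^bsub>\<Gamma>\<^esub> a (last p) (hd p) = \<one>\<^bsub>\<Gamma>\<^esub>"
    by (auto simp: has_balanced_cycle_def)
  have ne: "p \<noteq> []" "last p \<noteq> hd p" "hd p \<in> verts D"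
    using p by (cases p; auto)+
  note w = walk[OF ne(1) p(1) ne(2) p(3) ne(3)]
  have "walk p (hd p) \<noteq> []" using ne by (cases p) (auto simp: walk_def)
  moreover have "distinct (tl p @ [hd p])" using p(1) ne(1) by (cases p) auto
  ultimately have "D.cycle (walk p (hd p))"
    unfolding D.cycle_def D.awalk_def using w ne by (intro exI[of _ "hd p"]) auto
  then show ?thesis using w p(4) by (auto simp: balanced_cycle_def)
qed

section \<open>Lower bound\<close>

lemma complete_digraph_without_balanced_cycle:
  assumes "m \<le> q"
  obtains D :: "(nat, nat \<times> nat) pre_digraph" and lab
  where "complete_digraph m D" "labelling (integer_mod_group q) D lab"
    "\<nexists>p. balanced_cycle (integer_mod_group q) D lab p"
proof -
  define D :: "(nat, nat \<times> nat) pre_digraph" where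
    "D = with_proj \<lparr>pverts = {..<m}, parcs = {(u, v). u \<in> {..<m} \<and> v \<in> {..<m} \<and> u \<noteq> v}\<rparr>"
  define lab :: "nat \<times> nat \<Rightarrow> int" where "lab e = (if snd e < fst e then 1 else 0)" for e
  have D: "complete_digraph m D"
    unfolding D_def complete_digraph_pair_def by auto
  interpret D: graph D using D by (simp add: complete_digraph_def)
  have sel: "verts D = {..<m}" "tail D = fst" "head D = snd"
    "arcs D = {(u, v). u \<in> {..<m} \<and> v \<in> {..<m} \<and> u \<noteq> v}"
    by (simp_all add: D_def)
  have "labelling (integer_mod_group q) D lab"
    using assms by (auto simp: labelling_def lab_def sel carrier_integer_mod_group)
  moreover have "\<nexists>p. balanced_cycle (integer_mod_group q) D lab p"
  proof
    assume "\<exists>p. balanced_cycle (integer_mod_group q) D lab p"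
    then obtain u p where p: "D.awalk u p u" "distinct (tl (D.awalk_verts u p))" "p \<noteq> []"
      and zero: "walk_label (integer_mod_group q) lab p = 0"
      by (auto simp: balanced_cycle_def D.cycle_def)
    define c where "c = length (filter (\<lambda>e. snd e < fst e) p)"
    have "walk_label (integer_mod_group q) lab r
        = int (length (filter (\<lambda>e. snd e < fst e) r)) mod int q" for r
      by (induction r) (auto simp: walk_label_def lab_def mod_simps add.commute)
    with zero have dvd: "q dvd c" by (auto simp: c_def)
    have arcs: "set p \<subseteq> arcs D" "D.cas u p u" using p(1) by (auto simp: D.awalk_def)
    \<comment> \<open>A closed walk has arcs in both directions, so
      \<open>0 < c < length p \<le> q\<close>, contradicting \<open>q dvd c\<close>.\<close>
    have "c \<noteq> 0"
    proof
      assume "c = 0"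
      then have "tail D e < head D e" if "e \<in> set p" for e
        using that arcs(1) by (force simp: c_def sel filter_empty_conv)
      from D.trans_along_walk[OF arcs(2) p(3) transp_on_less this] show False by simp
    qed
    moreover have "c \<noteq> length p"
    proof
      assume "c = length p"
      then have "\<forall>e\<in>set p. snd e < fst e"
        unfolding c_def by (metis filter_id_conv length_filter_less less_irrefl)
      then have "tail D e > head D e" if "e \<in> set p" for e
        using that by (simp add: sel)
      from D.trans_along_walk[OF arcs(2) p(3) transp_on_greater this] show False by simp
    qed
    moreover have "c \<le> length p" by (simp add: c_def)
    moreover have "length p \<le> q"
    proof -
      \<comment> \<open>Dropping the first entry of \<open>awalk_verts\<close> leaves one distinct
        vertex per arc.\<close>
      have "length p = card (set (tl (D.awalk_verts u p)))"
        using p(2) by (simp add: distinct_card D.length_awalk_verts)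
      also have "\<dots> \<le> card {..<m}"
      proof (rule card_mono)
        have "set (tl (D.awalk_verts u p)) \<subseteq> set (D.awalk_verts u p)"
          by (meson D.awalk_verts_non_Nil list.set_sel(2) subsetI)
        also have "\<dots> \<subseteq> verts D" using p(1) by blast
        finally show "set (tl (D.awalk_verts u p)) \<subseteq> {..<m}" by (simp add: sel)
      qed simp
      finally show ?thesis using assms by simp
    qed
    ultimately show False using dvd by (auto dest: dvd_imp_le)
  qed
  ultimately show thesis using that D by blast
qed

theorem mainTheorem2:
  fixes q :: nat
  assumes "0 < q" and "odd q"
  shows "balanced_cycle_number (integer_mod_group q) = q + 1"
  unfolding balanced_cycle_number_def
proof (rule Least_equality, intro conjI allI impI)
  fix D :: "(nat, nat \<times> nat) pre_digraph" and lab
  assume "complete_digraph (q + 1) D \<and> labelling (integer_mod_group q) D lab"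
  then show "\<exists>p. balanced_cycle (integer_mod_group q) D lab p"
    using assms
    by (intro complete_digraph_has_balanced_cycle[of _ "q + 1"]) (auto simp: carrier_integer_mod_group)
next
  fix m :: nat
  assume m: "0 < m \<and> (\<forall>(D :: (nat, nat \<times> nat) pre_digraph) lab.
    complete_digraph m D \<and> labelling (integer_mod_group q) D lab
      \<longrightarrow> (\<exists>p. balanced_cycle (integer_mod_group q) D lab p))"
  show "q + 1 \<le> m"
  proof (rule ccontr)
    assume "\<not> q + 1 \<le> m"
    then have "m \<le> q" by simp
    from complete_digraph_without_balanced_cycle[OF this] m show False by metis
  qed
qed simp

end
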